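(* Let $\mathbb{F}$ be a field with $|\mathbb{F}|>2$ and let $m\ge 3$ be an integer. Then there is a full-rank aperiodic semiprojective tiling $(U,V)$ of $\mathbb{F}^{2m}$ with $|U|=|V|=|\mathbb{F}|^m$.
   Context: A pair $(U,V)$ of subsets of a vector space $\mathbb{S}$ is a tiling if every element of $\mathbb{S}$ is uniquely represented as $u+v$ with $u\in U$, $v\in V$. The tiling is semiprojective if $U$ is projective, i.e., $\mathbb{F}\cdot U=U$ (a union of $1$-dimensional subspaces). A subset is full-rank if its affine span is the whole space; a tiling is full-rank if both $U$ and $V$ are full-rank. A period of a set $X$ is a vector $w$ with $X+w=X$; $X$ is aperiodic if its only period is $0$; a tiling is aperiodic if both $U$ and $V$ are aperiodic. *)

theory Defs
  imports "HOL-Analysis.Analysis" "HOL-Library.Equipollence"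
begin

definition tiling :: "'v::ab_group_add set \<Rightarrow> 'v set \<Rightarrow> bool" where
  "tiling U V \<longleftrightarrow> (\<forall>s. \<exists>!(u, v). u \<in> U \<and> v \<in> V \<and> s = u + v)"

definition projective :: "('f::field ^ 'n) set \<Rightarrow> bool" where
  "projective U \<longleftrightarrow> {c *s u | c u. u \<in> U} = U"

definition semiprojective_tiling :: "('f::field ^ 'n) set \<Rightarrow> ('f ^ 'n) set \<Rightarrow> bool" where
  "semiprojective_tiling U V \<longleftrightarrow> tiling U V \<and> projective U"

text \<open>The library's \<^term>\<open>affine hull S\<close> is restricted to real vector spaces; this is the
  affine span over an arbitrary field, as the set of all finite affine combinations.\<close>

definition affine_span :: "('f::field ^ 'n) set \<Rightarrow> ('f ^ 'n) set" where
  "affine_span X =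
     {\<Sum>x\<in>T. c x *s x | T c. finite T \<and> T \<subseteq> X \<and> (\<Sum>x\<in>T. c x) = 1}"

definition full_rank :: "('f::field ^ 'n) set \<Rightarrow> bool" where
  "full_rank X \<longleftrightarrow> affine_span X = UNIV"

definition full_rank_tiling :: "('f::field ^ 'n) set \<Rightarrow> ('f ^ 'n) set \<Rightarrow> bool" where
  "full_rank_tiling U V \<longleftrightarrow> tiling U V \<and> full_rank U \<and> full_rank V"

definition is_period :: "'v::ab_group_add \<Rightarrow> 'v set \<Rightarrow> bool" where
  "is_period w X \<longleftrightarrow> (\<lambda>x. x + w) ` X = X"

definition aperiodic :: "'v::ab_group_add set \<Rightarrow> bool" where
  "aperiodic X \<longleftrightarrow> (\<forall>w. is_period w X \<longrightarrow> w = 0)"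

definition aperiodic_tiling :: "'v::ab_group_add set \<Rightarrow> 'v set \<Rightarrow> bool" where
  "aperiodic_tiling U V \<longleftrightarrow> tiling U V \<and> aperiodic U \<and> aperiodic V"

end

theory Submission
  imports Defs
begin

text \<open>
  Write a vector of \<open>F\<^bsup>2m\<^esup>\<close> as \<open>(a, b)\<close> with \<open>a, b \<in> F\<^bsup>m\<^esup>\<close>. The tiling is
  \<open>U = {(g(b), b)}\<close> and \<open>V = {(a, f(a))}\<close>, where \<open>f\<close> applies the indicator function of 1 to each
  coordinate, and \<open>g\<^sub>i(b) = b\<^bsub>i+1\<^esub>\<close> if \<open>b\<close> lies in the span of the unit vectors \<open>e\<^sub>i\<close> and
  \<open>e\<^bsub>i+1\<^esub>\<close> (indices modulo \<open>m\<close>) and \<open>g\<^sub>i(b) = 0\<close> otherwise. The \<open>g\<^sub>i\<close> are homogeneous, have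
  pairwise disjoint supports, and \<open>g\<^sub>i\<close> does not depend on \<open>b\<^sub>i\<close>. Hence \<open>g\<close> is unchanged
  when \<open>b\<close> is modified in coordinates \<open>j\<close> with \<open>g\<^sub>j(b) \<noteq> 0\<close>. Since \<open>f\<close> acts coordinatewise, this
  lets one solve \<open>(s, t) = (g(b) + a, b + f(a))\<close> uniquely by \<open>a = s - g(t - f(s))\<close>. A third field
  element makes \<open>x\<close> and the indicator of 1 linearly independent and the latter aperiodic modulo
  constants.
\<close>

section \<open>Field size, affine spans and cardinalities\<close>

lemma ex_third_element:
  assumes "{..<2::nat} \<prec> (UNIV :: 'a set)"
  shows "\<exists>z::'a. z \<noteq> a \<and> z \<noteq> b"
proof (rule ccontr)
  assume "\<not> ?thesis"
  then have "(UNIV :: 'a set) \<subseteq> {a, b}"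
    by blast
  also have "{a, b} = (\<lambda>i::nat. if i = 0 then a else b) ` {..<2}"
    by (simp add: lessThan_Suc numeral_2_eq_2 insert_commute)
  finally have "(UNIV :: 'a set) \<subseteq> (\<lambda>i::nat. if i = 0 then a else b) ` {..<2}" .
  then have "(UNIV :: 'a set) \<lesssim> {..<2::nat}"
    unfolding lepoll_iff by blast
  then show False
    using assms lepoll_antisym unfolding lesspoll_def by blast
qed

text \<open>The coefficient of 0 is free, so it can absorb whatever makes the weights sum to 1;
  affine and linear span therefore coincide.\<close>

lemma full_rankI:
  fixes X :: "('f::field ^ 'n::finite) set"
  assumes "0 \<in> X" and axes: "\<And>k. axis k 1 \<in> vec.span X"
  shows "full_rank X"
proof -
  have "cart_basis \<subseteq> vec.span X"
    using axes by (auto simp: cart_basis_def)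
  then have "vec.span X = UNIV"
    by (metis span_cart_basis vec.span_minimal vec.subspace_span top.extremum_unique)
  have "x \<in> affine_span X" for x
  proof -
    from \<open>vec.span X = UNIV\<close> obtain T c where T: "finite T" "T \<subseteq> X" "x = (\<Sum>a\<in>T. c a *s a)"
      unfolding vec.span_explicit by blast
    define d where "d = c(0 := 1 - sum c (T - {0}))"
    have "x = (\<Sum>a\<in>T - {0}. c a *s a)"
      unfolding T(3) using T(1) by (intro sum.mono_neutral_right) auto
    also have "\<dots> = (\<Sum>a\<in>T - {0}. d a *s a)"
      by (rule sum.cong) (auto simp: d_def)
    also have "\<dots> = (\<Sum>a\<in>insert 0 T. d a *s a)"
      using T(1) by (simp add: sum.insert_remove)
    finally have x: "x = (\<Sum>a\<in>insert 0 T. d a *s a)" .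
    have "sum d (T - {0}) = sum c (T - {0})"
      by (rule sum.cong) (auto simp: d_def)
    then have "sum d (insert 0 T) = 1"
      using T(1) by (simp add: sum.insert_remove) (simp add: d_def)
    with x T \<open>0 \<in> X\<close> show ?thesis
      unfolding affine_span_def by blast
  qed
  then show ?thesis
    unfolding full_rank_def by blast
qed

text \<open>Restriction to the coordinates in \<open>K\<close> is a bijection on a graph over them;
  \<open>e\<close> only renames \<open>K\<close> to the wanted index set.\<close>

lemma eqpoll_PiE_of_coordinates:
  fixes X :: "('f ^ 'n::finite) set"
  assumes e: "bij_betw e I K"
    and ex: "\<And>t. \<exists>x\<in>X. \<forall>k\<in>K. x $ k = t k"
    and un: "\<And>x y. x \<in> X \<Longrightarrow> y \<in> X \<Longrightarrow> (\<And>k. k \<in> K \<Longrightarrow> x $ k = y $ k) \<Longrightarrow> x = y"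
  shows "X \<approx> (I \<rightarrow>\<^sub>E (UNIV :: 'f set))"
proof -
  let ?h = "\<lambda>x. restrict (\<lambda>i. x $ e i) I"
  have "inj_on ?h X"
  proof (rule inj_onI)
    fix x y assume xy: "x \<in> X" "y \<in> X" "?h x = ?h y"
    have "x $ k = y $ k" if k: "k \<in> K" for k
    proof -
      from k e obtain i where "i \<in> I" "k = e i"
        by (auto simp: bij_betw_def)
      with fun_cong[OF xy(3), of i] show ?thesis by simp
    qed
    with un xy show "x = y" by blast
  qed
  moreover have "y \<in> ?h ` X" if y: "y \<in> I \<rightarrow>\<^sub>E UNIV" for y
  proof -
    obtain x where x: "x \<in> X" "\<forall>k\<in>K. x $ k = y (the_inv_into I e k)"
      using ex[of "\<lambda>k. y (the_inv_into I e k)"] by blast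
    have "?h x i = y i" for i
    proof (cases "i \<in> I")
      case True
      then have "e i \<in> K" "the_inv_into I e (e i) = i"
        using e by (auto simp: bij_betw_def the_inv_into_f_f)
      with x(2) True show ?thesis by simp
    next
      case False
      then show ?thesis using PiE_arb[OF y False] by simp
    qed
    then have "?h x = y" ..
    with x(1) show ?thesis by blast
  qed
  ultimately have "bij_betw ?h X (I \<rightarrow>\<^sub>E UNIV)"
    by (auto simp: bij_betw_def)
  then show ?thesis
    unfolding eqpoll_def by blast
qed

text \<open>Coordinates in \<open>P\<close> carry the \<open>a\<close>-part of a vector, the others the \<open>b\<close>-part: \<open>r i\<close> is the
  \<open>b\<close>-coordinate paired with \<open>i\<close>, \<open>q\<close> is the inverse of \<open>r\<close>, and \<open>s\<close> is the cyclic shift.\<close>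

locale paired_coordinates =
  fixes P :: "'n::finite set" and r q s :: "'n \<Rightarrow> 'n" and field_type :: "'f::field itself"
  assumes third: "\<exists>z::'f. z \<noteq> a \<and> z \<noteq> b"
    and r_notin: "i \<in> P \<Longrightarrow> r i \<notin> P"
    and q_in: "k \<notin> P \<Longrightarrow> q k \<in> P"
    and r_q: "k \<notin> P \<Longrightarrow> r (q k) = k"
    and q_r: "i \<in> P \<Longrightarrow> q (r i) = i"
    and s_in: "i \<in> P \<Longrightarrow> s i \<in> P"
    and s_inj: "inj_on s P"
    and s_neq: "i \<in> P \<Longrightarrow> s i \<noteq> i"
    and s_s_neq: "i \<in> P \<Longrightarrow> s (s i) \<noteq> i"
begin

definition f :: "'f \<Rightarrow> 'f" where
  "f x = (if x = 1 then 1 else 0)"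

definition g :: "'n \<Rightarrow> 'f ^ 'n \<Rightarrow> 'f" where
  "g i u = (if \<forall>j\<in>P. j \<noteq> i \<longrightarrow> j \<noteq> s i \<longrightarrow> u $ r j = 0 then u $ r (s i) else 0)"

definition U :: "('f ^ 'n) set" where
  "U = {u. \<forall>i\<in>P. u $ i = g i u}"

definition V :: "('f ^ 'n) set" where
  "V = {v. \<forall>k. k \<notin> P \<longrightarrow> v $ k = f (v $ q k)}"

text \<open>Graph parametrisation: the point of \<open>U\<close> with the b-part of
  \<open>t\<close>. Likewise \<open>lift_V\<close> keeps the a-part.\<close>

definition lift_U :: "'f ^ 'n \<Rightarrow> 'f ^ 'n" where
  "lift_U t = (\<chi> k. if k \<in> P then g k t else t $ k)"

definition lift_V :: "'f ^ 'n \<Rightarrow> 'f ^ 'n" where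
  "lift_V t = (\<chi> k. if k \<in> P then t $ k else f (t $ q k))"

section \<open>Graph properties and the supports of \<open>g\<close>\<close>

lemma r_eq_iff: "i \<in> P \<Longrightarrow> j \<in> P \<Longrightarrow> r i = r j \<longleftrightarrow> i = j"
  by (metis q_r)

lemma g_cong:
  assumes "\<And>j. j \<in> P \<Longrightarrow> u $ r j = u' $ r j" and "i \<in> P"
  shows "g i u = g i u'"
  using assms s_in by (auto simp: g_def)

lemma g_scale: "g i (c *s u) = c * g i u"
  by (auto simp: g_def)

lemma lift_U_in: "lift_U t \<in> U"
proof -
  have "g i (lift_U t) = g i t" if "i \<in> P" for i
    using that by (intro g_cong) (auto simp: lift_U_def r_notin)
  then show ?thesis
    by (simp add: U_def) (simp add: lift_U_def)
qed

lemma lift_V_in: "lift_V t \<in> V"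
  by (simp add: V_def lift_V_def q_in)

lemma U_eqI:
  assumes "u \<in> U" "u' \<in> U" and eq: "\<And>k. k \<notin> P \<Longrightarrow> u $ k = u' $ k"
  shows "u = u'"
proof -
  have "u $ i = u' $ i" if "i \<in> P" for i
    using assms that g_cong[of u u' i] by (simp add: U_def r_notin)
  with eq show ?thesis
    by (metis vec_eq_iff)
qed

lemma V_eqI:
  assumes "v \<in> V" "v' \<in> V" and eq: "\<And>i. i \<in> P \<Longrightarrow> v $ i = v' $ i"
  shows "v = v'"
  unfolding vec_eq_iff
proof
  fix k show "v $ k = v' $ k"
    using assms q_in[of k] by (cases "k \<in> P") (simp_all add: V_def)
qed

text \<open>Each nonzero value makes one coordinate nonzero that the other condition must tolerate.
  As \<open>s\<close> is injective, this leaves only \<open>s i = j\<close> and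
  \<open>s j = i\<close>, a 2-cycle, which \<open>s\<close> does not have.\<close>

lemma g_disjoint_supports:
  assumes "i \<in> P" "j \<in> P" "g i u \<noteq> 0" "g j u \<noteq> 0"
  shows "i = j"
proof (rule ccontr)
  assume "i \<noteq> j"
  have "s i = j \<or> s i = s j" "s j = i \<or> s j = s i"
    using assms s_in by (auto simp: g_def split: if_splits)
  moreover have "s i \<noteq> s j"
    using s_inj assms \<open>i \<noteq> j\<close> by (auto dest: inj_onD)
  ultimately show False
    using s_s_neq assms by metis
qed

text \<open>At most one \<open>g j\<close> is nonzero at \<open>u\<close>, and \<open>u'\<close> can
  differ only in the b-coordinate \<open>r j\<close>, which \<open>g j\<close> ignores. So
  \<open>g j\<close> stays nonzero, and disjoint supports make all others vanish at
  \<open>u'\<close> too.\<close>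

lemma g_invariant:
  assumes eq: "\<And>j. j \<in> P \<Longrightarrow> g j u = 0 \<Longrightarrow> u $ r j = u' $ r j" and i: "i \<in> P"
  shows "g i u' = g i u"
proof (cases "\<forall>j\<in>P. g j u = 0")
  case True
  then show ?thesis
    using eq i by (intro g_cong) auto
next
  case False
  then obtain j where j: "j \<in> P" "g j u \<noteq> 0" by blast
  have eq': "u $ r k = u' $ r k" if "k \<in> P" "k \<noteq> j" for k
    using that eq g_disjoint_supports j by blast
  have "g j u' = g j u"
    using eq' j s_in s_neq by (auto simp: g_def)
  then show ?thesis
    using g_disjoint_supports i j by metis
qed

section \<open>The tiling property and projectivity\<close>

lemma tiling_U_V: "tiling U V"
  unfolding tiling_def
proof
  fix z :: "'f ^ 'n"
  define d where "d = z - lift_V z"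
  define v where "v = lift_V (\<chi> i. z $ i - g i d)"
  have v_P: "v $ i = z $ i - g i d" if "i \<in> P" for i
    using that by (simp add: v_def lift_V_def)
  have "v \<in> V"
    by (simp add: v_def lift_V_in)
  \<comment> \<open>Since \<open>f\<close> acts coordinatewise, \<open>z - x\<close> and
    \<open>d\<close> can differ in b-coordinates only where \<open>x\<close> and \<open>z\<close>
    differ in the paired a-coordinate.\<close>
  have r_coord: "(z - x) $ r j = d $ r j" if "x \<in> V" "j \<in> P" "x $ j = z $ j" for x j
    using that r_notin q_r by (simp add: V_def d_def lift_V_def)
  have "g i (z - v) = g i d" if "i \<in> P" for i
    using that r_coord[OF \<open>v \<in> V\<close>] v_P by (intro g_invariant) simp_all
  then have "z - v \<in> U"
    by (simp add: U_def v_P)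
  have unique: "y = v" if y: "y \<in> V" "z - y \<in> U" for y
  proof (rule V_eqI)
    fix i assume i: "i \<in> P"
    have yj: "y $ j = z $ j - g j (z - y)" if "j \<in> P" for j
      using y(2) that by (simp add: U_def) (metis add_diff_cancel_left' diff_diff_eq2 diff_add_cancel)
    \<comment> \<open>Invariance with base point \<open>z - y\<close> and perturbation
      \<open>d\<close>, the reverse of its use for existence.\<close>
    have "g i d = g i (z - y)"
      using i r_coord[OF y(1)] yj by (intro g_invariant) simp_all
    then show "y $ i = v $ i"
      using yj i v_P by simp
  qed (fact y(1), fact \<open>v \<in> V\<close>)
  show "\<exists>!(u, v). u \<in> U \<and> v \<in> V \<and> z = u + v"
  proof (rule ex1I[of _ "(z - v, v)"])
    show "case (z - v, v) of (u, v) \<Rightarrow> u \<in> U \<and> v \<in> V \<and> z = u + v"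
      using \<open>v \<in> V\<close> \<open>z - v \<in> U\<close> by simp
  next
    fix p assume "case p of (u, v) \<Rightarrow> u \<in> U \<and> v \<in> V \<and> z = u + v"
    then show "p = (z - v, v)"
      using unique by (cases p) (auto simp: algebra_simps)
  qed
qed

lemma projective_U: "projective U"
proof -
  have "c *s u \<in> U" if "u \<in> U" for c u
    using that by (simp add: U_def g_scale)
  moreover have "\<exists>c v. u = c *s v \<and> v \<in> U" if "u \<in> U" for u
    using that by (intro exI[of _ 1] exI[of _ u]) simp
  ultimately show ?thesis
    unfolding projective_def by blast
qed

section \<open>Full rank\<close>

lemma g_zero [simp]: "g i 0 = 0"
  by (simp add: g_def)

lemma zero_in_U: "0 \<in> U"
  by (simp add: U_def)

lemma zero_in_V: "0 \<in> V"
  by (simp add: V_def f_def)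

lemma g_axes:
  assumes "i \<in> P" "j \<in> P"
  shows "g j (c *s axis (r i) 1 + axis (r (s i)) 1) = (if j = i then 1 else 0)"
proof -
  let ?u = "c *s axis (r i) 1 + axis (r (s i)) (1::'f)"
  have "g i ?u = 1"
    using assms s_in s_neq by (auto simp: g_def axis_def r_eq_iff)
  then show ?thesis
    using g_disjoint_supports[of i j ?u] assms by auto
qed

lemma axes_in_U:
  assumes i: "i \<in> P"
  shows "axis i 1 + (c *s axis (r i) 1 + axis (r (s i)) 1) \<in> U" (is "?x \<in> U")
proof -
  let ?u = "c *s axis (r i) 1 + axis (r (s i)) (1::'f)"
  have "?x $ k = lift_U ?u $ k" for k
    using i r_notin[OF i] r_notin[OF s_in[OF i]] g_axes[OF i, of k c]
    by (auto simp: lift_U_def axis_def)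
  then have "?x = lift_U ?u"
    by (simp add: vec_eq_iff)
  then show ?thesis
    by (simp only: lift_U_in)
qed

lemma full_rank_U: "full_rank U"
proof (rule full_rankI[OF zero_in_U])
  have r_axis: "axis (r i) 1 \<in> vec.span U" if i: "i \<in> P" for i
  proof -
    \<comment> \<open>As \<open>g i\<close> ignores coordinate \<open>r i\<close>, two points of
      \<open>U\<close> differ by exactly that unit vector.\<close>
    have "(axis i 1 + (1 *s axis (r i) 1 + axis (r (s i)) 1))
        - (axis i 1 + (0 *s axis (r i) 1 + axis (r (s i)) 1)) \<in> vec.span U"
      using axes_in_U[OF i] by (intro vec.span_diff vec.span_base)
    then show ?thesis by simp
  qed
  fix k show "axis k 1 \<in> vec.span U"
  proof (cases "k \<in> P")
    case True
    have "(axis k 1 + (0 *s axis (r k) 1 + axis (r (s k)) 1)) - axis (r (s k)) 1 \<in> vec.span U"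
      by (intro vec.span_diff[OF vec.span_base] axes_in_U r_axis s_in True)
    then show ?thesis by simp
  next
    case False
    then show ?thesis
      using r_axis[OF q_in] r_q by simp
  qed
qed

lemma axes_in_V:
  assumes i: "i \<in> P"
  shows "c *s axis i 1 + f c *s axis (r i) 1 \<in> V"
proof -
  have "k = r i \<longleftrightarrow> q k = i" "q k \<noteq> r i" if "k \<notin> P" for k
    using that i r_q q_r q_in r_notin by metis+
  then show ?thesis
    using i r_notin[OF i] by (auto simp: V_def axis_def f_def)
qed

lemma full_rank_V: "full_rank V"
proof (rule full_rankI[OF zero_in_V])
  \<comment> \<open>With \<open>f z = 0\<close>, a nonzero multiple of \<open>axis i 1\<close> lies
    in \<open>V\<close> itself.\<close>
  obtain z :: 'f where z: "z \<noteq> 0" "z \<noteq> 1"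
    using third by blast
  have P_axis: "axis i 1 \<in> vec.span V" if i: "i \<in> P" for i
  proof -
    have "inverse z *s (z *s axis i 1 + f z *s axis (r i) 1) \<in> vec.span V"
      using axes_in_V[OF i] by (intro vec.span_scale vec.span_base)
    then show ?thesis
      using z by (simp add: f_def)
  qed
  fix k show "axis k 1 \<in> vec.span V"
  proof (cases "k \<in> P")
    case True
    then show ?thesis by (rule P_axis)
  next
    case False
    have "(1 *s axis (q k) 1 + f 1 *s axis (r (q k)) 1) - axis (q k) 1 \<in> vec.span V"
      by (intro vec.span_diff[OF vec.span_base] axes_in_V P_axis q_in False)
    then show ?thesis
      using r_q[OF False] by (simp add: f_def)
  qed
qed

section \<open>Aperiodicity\<close>

lemma aperiodic_U: "aperiodic U"
  unfolding aperiodic_def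
proof (intro allI impI)
  fix w assume "is_period w U"
  then have shift: "u + w \<in> U" if "u \<in> U" for u
    using that by (auto simp: is_period_def)
  then have "w \<in> U"
    using zero_in_U by force
  have w_r: "w $ r k = 0" if k: "k \<in> P" for k
  proof (rule ccontr)
    assume nz: "w $ r k \<noteq> 0"
    \<comment> \<open>This choice makes \<open>k\<close> differ from both \<open>i\<close> and
      \<open>s i\<close>, so a nonzero entry at \<open>r k\<close> kills \<open>g i\<close>. Adding
      \<open>w\<close> to the \<open>u\<close> below keeps that entry nonzero, yet \<open>u\<close>
      contributes 1 at coordinate \<open>i\<close>.\<close>
    define i where "i = s k"
    have i: "i \<in> P" "k \<noteq> i" "k \<noteq> s i"
      using k s_in s_neq s_s_neq by (metis i_def)+
    have zero: "g i x = 0" if "x $ r k \<noteq> 0" for x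
      using that i k by (auto simp: g_def)
    define u where "u = axis i 1 + (0 *s axis (r i) 1 + axis (r (s i)) (1::'f))"
    have "u \<in> U"
      unfolding u_def by (rule axes_in_U[OF i(1)])
    have "u $ i = 1" "u $ r k = 0"
      using i k r_notin[OF k] r_notin[OF s_in[OF i(1)]] s_in by (auto simp: u_def axis_def r_eq_iff)
    have "(u + w) $ i = g i (u + w)" "w $ i = g i w"
      using shift[OF \<open>u \<in> U\<close>] \<open>w \<in> U\<close> i by (simp_all add: U_def)
    then show False
      using zero[of "u + w"] zero[OF nz] nz \<open>u $ i = 1\<close> \<open>u $ r k = 0\<close> by simp
  qed
  show "w = 0"
    using \<open>w \<in> U\<close> zero_in_U w_r q_in r_q by (intro U_eqI) (simp_all, metis)
qed

text \<open>A point \<open>z\<close> with neither \<open>z\<close> nor \<open>z + p\<close> equal to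
  1 forces \<open>c = 0\<close>; then \<open>f (1 + p) = 1\<close>.\<close>

lemma f_aperiodic_mod_constants:
  assumes "\<And>x. f (x + p) = f x + c"
  shows "p = 0"
proof (rule ccontr)
  assume p: "p \<noteq> 0"
  obtain z where z: "z \<noteq> 1" "z \<noteq> 1 - p"
    using third by blast
  then have "z + p \<noteq> 1"
    by (auto simp: algebra_simps)
  then have "c = 0"
    using assms[of z] z by (simp add: f_def)
  then show False
    using assms[of 1] p by (simp add: f_def)
qed

lemma aperiodic_V: "aperiodic V"
  unfolding aperiodic_def
proof (intro allI impI)
  fix w assume "is_period w V"
  then have shift: "v + w \<in> V" if "v \<in> V" for v
    using that by (auto simp: is_period_def)
  then have "w \<in> V"
    using zero_in_V by force
  have "w $ i = 0" if i: "i \<in> P" for i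
  proof (rule f_aperiodic_mod_constants)
    fix x
    \<comment> \<open>A constant a-part realises any value \<open>x\<close> at coordinate
      \<open>i\<close>.\<close>
    have "lift_V (\<chi> k. x) + w \<in> V"
      by (intro shift lift_V_in)
    then show "f (x + w $ i) = f x + w $ r i"
      using i r_notin q_r by (auto simp: V_def lift_V_def dest!: spec[of _ "r i"])
  qed
  then show "w = 0"
    using \<open>w \<in> V\<close> zero_in_V by (intro V_eqI) simp_all
qed

section \<open>Cardinalities and the concrete coordinate pairing\<close>

lemma U_eqpoll:
  assumes "bij_betw e I (- P)"
  shows "U \<approx> (I \<rightarrow>\<^sub>E (UNIV :: 'f set))"
proof (rule eqpoll_PiE_of_coordinates[OF assms])
  fix t :: "'n \<Rightarrow> 'f"
  show "\<exists>x\<in>U. \<forall>k\<in>- P. x $ k = t k"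
    by (rule bexI[OF _ lift_U_in[of "\<chi> k. t k"]]) (simp add: lift_U_def)
qed (auto intro: U_eqI)

lemma V_eqpoll:
  assumes "bij_betw e I P"
  shows "V \<approx> (I \<rightarrow>\<^sub>E (UNIV :: 'f set))"
proof (rule eqpoll_PiE_of_coordinates[OF assms])
  fix t :: "'n \<Rightarrow> 'f"
  show "\<exists>x\<in>V. \<forall>k\<in>P. x $ k = t k"
    by (rule bexI[OF _ lift_V_in[of "\<chi> k. t k"]]) (simp add: lift_V_def)
qed (auto intro: V_eqI)

end

theorem theorem1:
  fixes m :: nat
  assumes "{..<2::nat} \<prec> (UNIV :: 'f::field set)"
    and "m \<ge> 3"
    and "CARD('n::finite) = 2 * m"
  shows "\<exists>U V :: ('f ^ 'n) set.
           semiprojective_tiling U V \<and> full_rank_tiling U V \<and> aperiodic_tiling U V \<and>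
           U \<approx> ({..<m} \<rightarrow>\<^sub>E (UNIV :: 'f set)) \<and>
           V \<approx> ({..<m} \<rightarrow>\<^sub>E (UNIV :: 'f set))"
proof -
  obtain h :: "nat \<Rightarrow> 'n" where h: "bij_betw h {..<2 * m} UNIV"
    using ex_bij_betw_nat_finite[of "UNIV :: 'n set"] assms(3) by (auto simp: atLeast0LessThan)
  define l where "l = the_inv_into {..<2 * m} h"
  have l_h: "l (h i) = i" if "i < 2 * m" for i
    using that h by (simp add: l_def bij_betw_def the_inv_into_f_f)
  have h_l: "h (l k) = k" and l_less: "l k < 2 * m" for k
    using h f_the_inv_into_f_bij_betw[of h "{..<2 * m}" UNIV k]
      the_inv_into_into[of h "{..<2 * m}" k "{..<2 * m}"]
    by (auto simp: l_def bij_betw_def)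
  have l_diff_less: "l k - m < m" for k
    using l_less[of k] assms(2) by linarith
  \<comment> \<open>Indices below \<open>m\<close> form the a-part, and \<open>i\<close> is paired
    with \<open>i + m\<close>. The cyclic successor modulo \<open>m\<close> has no fixed points or
    2-cycles because \<open>m \<ge> 3\<close>.\<close>
  define P where "P = {k. l k < m}"
  define s where "s k = h (Suc (l k) mod m)" for k
  have l_s: "l (s k) = Suc (l k) mod m" for k
    unfolding s_def using assms(2) by (intro l_h) (simp add: less_le_trans[OF mod_less_divisor])
  have l_inj: "k = k'" if "l k = l k'" for k k'
    using that h_l by metis
  interpret paired_coordinates P "\<lambda>k. h (l k + m)" "\<lambda>k. h (l k - m)" s "TYPE('f)"
  proof
    show "\<exists>z::'f. z \<noteq> a \<and> z \<noteq> b" for a b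
      by (rule ex_third_element[OF assms(1)])
    show "inj_on s P"
    proof (rule inj_onI)
      fix i j assume ij: "i \<in> P" "j \<in> P" "s i = s j"
      then have "Suc (l i) mod m = Suc (l j) mod m"
        using l_s by metis
      then have "l i = l j"
        using ij(1,2) by (auto simp: P_def mod_Suc split: if_splits)
      then show "i = j" by (rule l_inj)
    qed
    fix k
    \<comment> \<open>Truncated subtraction keeps the index in range for every
      \<open>k\<close>.\<close>
    have "l (h (l k - m)) = l k - m"
      using l_less[of k] by (intro l_h) simp
    then show "h (l k - m) \<in> P" "h (l (h (l k - m)) + m) = k" if "k \<notin> P"
      using that l_less[of k] h_l[of k] by (simp_all add: P_def)
    show "s k \<noteq> k" if "k \<in> P"
      using that l_s[of k] assms(2) by (auto simp: P_def mod_Suc split: if_splits)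
    show "s (s k) \<noteq> k" if "k \<in> P"
      using that l_s[of "s k"] l_s[of k] assms(2) by (auto simp: P_def mod_Suc split: if_splits)
    show "s k \<in> P" if "k \<in> P"
      using assms(2) by (simp add: P_def l_s)
  qed (simp_all add: P_def l_h h_l)
  have "bij_betw h {..<m} P"
    by (rule bij_betw_byWitness[of _ l]) (auto simp: P_def l_h h_l)
  moreover have "bij_betw (\<lambda>i. h (i + m)) {..<m} (- P)"
    by (rule bij_betw_byWitness[of _ "\<lambda>k. l k - m"])
      (auto simp: P_def l_h h_l l_diff_less)
  ultimately show ?thesis
    using tiling_U_V projective_U full_rank_U full_rank_V aperiodic_U aperiodic_V
      U_eqpoll V_eqpoll
    unfolding semiprojective_tiling_def full_rank_tiling_def aperiodic_tiling_def
    by blast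
qed

end
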